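(* For all $0\le h\le k$ and $i\ge0$, \[\psi(h,k+i)=\varphi^i(\psi(h,k)),\qquad \psi(h+i,k+i)=\varphi_R^i\big(\psi(h,k)\cdot k^{-1}\big)\cdot(k+i),\] where $\psi(h,k)\cdot k^{-1}$ denotes $\psi(h,k)$ with its last letter $k$ removed.
   Context: $\mathbb{N}=\{0,1,2,\ldots\}$ is an alphabet with its usual order; $x\cdot y$ denotes concatenation. An overlap is a word $cxcxc$ with $c$ a letter and $x$ a possibly empty word; overlap-free means having no overlap as a factor. Lexicographic order: $x\le y$ if $x$ is a prefix of $y$ or $x=wcx'$, $y=wdy'$ with letters $c<d$. For $0\le h\le k$, $\psi(h,k)$ is the lexicographically least overlap-free word over $\mathbb{N}$ that starts with the letter $h$ and ends with the letter $k$. $S^{-1}$ is the right cyclic shift $S^{-1}(xc)=cx$; $R$ is word reversal. The morphism $\varphi\colon\mathbb{N}^*\to\mathbb{N}^*$ is defined recursively by $\varphi(h)=S^{-1}(\varphi^h(00))\cdot(h+1)$ (well defined since $\varphi^h(00)$ involves only $\varphi$ on letters $<h$); e.g. $\varphi(0)=001$, $\varphi(1)=1001002$. $\varphi_R=R\circ\varphi\circ R$ is the reversed morphism, $\varphi_R(c)=R(\varphi(c))$. *)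

theory Defs
  imports Main "HOL-Library.Sublist" "HOL-Library.List_Lexorder"
begin

text \<open>
  Words over the alphabet of natural numbers are lists of type \<^typ>\<open>nat list\<close>. The order \<open>\<le>\<close>
  on them is the (total) lexicographic order of List_Lexorder: a word precedes all words that it
  is a prefix of, and otherwise the first position where two words differ decides.
\<close>

lemma word_le_iff:
  fixes x y :: "nat list"
  shows "x \<le> y \<longleftrightarrow>
    prefix x y \<or> (\<exists>w c d x' y'. x = w @ c # x' \<and> y = w @ d # y' \<and> c < d)"
  unfolding list_le_def list_less_def lexord_def prefix_def
  by (auto; metis append_Nil2 neq_Nil_conv)

definition overlap_free :: "'a list \<Rightarrow> bool" where
  "overlap_free w \<longleftrightarrow> \<not> (\<exists>c x. sublist ([c] @ x @ [c] @ x @ [c]) w)"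

definition overlap_free_from_to :: "nat \<Rightarrow> nat \<Rightarrow> nat list \<Rightarrow> bool" where
  "overlap_free_from_to h k w \<longleftrightarrow> overlap_free w \<and> w \<noteq> [] \<and> hd w = h \<and> last w = k"

definition psi :: "nat \<Rightarrow> nat \<Rightarrow> nat list" where
  "psi h k = (LEAST w. overlap_free_from_to h k w)"

definition right_shift :: "'a list \<Rightarrow> 'a list" where
  "right_shift w = (if w = [] then [] else last w # butlast w)"

text \<open>
  The guard \<open>c < h\<close> only serves the termination proof. It is always satisfied, and the unguarded
  defining equation is the lemma \<open>phi_letter_eq\<close> below.
\<close>

function phi_letter :: "nat \<Rightarrow> nat list" where
  "phi_letter h =
     right_shift (((\<lambda>w. concat (map (\<lambda>c. if c < h then phi_letter c else []) w)) ^^ h) [0, 0])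
     @ [h + 1]"
  by auto
termination by (relation "measure id") auto

declare phi_letter.simps [simp del]

definition phi :: "nat list \<Rightarrow> nat list" where
  "phi w = concat (map phi_letter w)"

definition phi_R :: "nat list \<Rightarrow> nat list" where
  "phi_R = rev \<circ> phi \<circ> rev"

lemma set_right_shift [simp]: "set (right_shift w) = set w"
  by (cases w rule: rev_cases) (auto simp: right_shift_def)

lemma phi_letter_aux:
  "phi_letter h = right_shift ((phi ^^ h) [0, 0]) @ [h + 1] \<and> (\<forall>c\<in>set (phi_letter h). c \<le> h + 1)"
proof (induction h rule: less_induct)
  case (less h)
  let ?g = "\<lambda>w. concat (map (\<lambda>c. if c < h then phi_letter c else []) w)"
  have "(?g ^^ j) [0, 0] = (phi ^^ j) [0, 0] \<and> (\<forall>c\<in>set ((phi ^^ j) [0, 0]). c \<le> j)"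
    if "j \<le> h" for j
    using that
  proof (induction j)
    case 0
    then show ?case by simp
  next
    case (Suc j)
    let ?w = "(phi ^^ j) [0, 0]"
    have w: "(?g ^^ j) [0, 0] = ?w" "\<And>c. c \<in> set ?w \<Longrightarrow> c \<le> j"
      using Suc by auto
    have "?g ?w = phi ?w"
    proof -
      have "c < h" if "c \<in> set ?w" for c
        using w(2)[OF that] Suc.prems by simp
      then have "map (\<lambda>c. if c < h then phi_letter c else []) ?w = map phi_letter ?w"
        by (intro map_cong) simp_all
      then show ?thesis by (simp only: phi_def[of ?w])
    qed
    moreover have "\<forall>c\<in>set (phi ?w). c \<le> Suc j"
    proof
      fix c assume "c \<in> set (phi ?w)"
      then obtain d where d: "d \<in> set ?w" "c \<in> set (phi_letter d)"
        by (auto simp: phi_def)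
      then have "d \<le> j" using w(2) by blast
      moreover have "c \<le> d + 1" using less.IH[of d] d(2) \<open>d \<le> j\<close> Suc.prems by auto
      ultimately show "c \<le> Suc j" by simp
    qed
    ultimately show ?case using w(1) by simp
  qed
  from this[of h] show ?case
    by (auto simp: phi_letter.simps[of h])
qed

lemma phi_letter_eq: "phi_letter h = right_shift ((phi ^^ h) [0, 0]) @ [h + 1]"
  using phi_letter_aux by blast

lemma phi_letter_0: "phi_letter 0 = [0, 0, 1]"
  by (simp add: phi_letter_eq right_shift_def)

lemma phi_letter_1: "phi_letter 1 = [1, 0, 0, 1, 0, 0, 2]"
  by (subst phi_letter_eq) (simp add: phi_def phi_letter_0 right_shift_def)

lemma phi_R_letter: "phi_R [c] = rev (phi_letter c)"
  by (simp add: phi_R_def phi_def)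

end

theory Submission
  imports Defs
begin

text \<open>
  Write \<open>(phi ^^ a) [0] = Q a @ [a]\<close>, so that \<open>phi_letter a = a # Q a @ a # Q a @ [a + 1]\<close>, where all
  letters of \<open>Q a\<close> are smaller than \<open>a\<close>. The claim is that \<open>psi h (h + n) = (phi ^^ n) [h]\<close>.

  Call a word greedy if lowering any letter but the first completes an overlap with the letters
  before it. The morphism \<open>phi\<close> preserves greediness: lowering the first letter of a block copies
  an overlap from the preimage, and lowering another letter creates an overlap inside the block,
  by induction on \<open>a\<close> for \<open>Q a @ [a]\<close>. A greedy overlap-free word whose last letter \<open>k\<close> occurs only
  there is least among the overlap-free words with the same first letter that end with \<open>k\<close>.

  The morphism \<open>phi\<close> also preserves overlap-freeness. In an overlap in \<open>phi w\<close>, mark the first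
  occurrence of the largest letter \<open>m\<close> in each half of the square. Both marked letters end blocks,
  because the other occurrences of \<open>m\<close> are ruled out by comparing neighbouring letters: \<open>Q a\<close> ends
  with \<open>0\<close>, but blocks do not. Hence the overlap can be decoded to one in \<open>w\<close>.

  The identity for \<open>phi_R\<close> holds because \<open>Q a\<close> is a palindrome, which makes \<open>phi\<close> and \<open>phi_R\<close> commute.
\<close>

section \<open>Iterates of \<open>phi\<close> and the shape of its blocks\<close>

lemma phi_Nil [simp]: "phi [] = []"
  by (simp add: phi_def)

lemma phi_Cons: "phi (a # w) = phi_letter a @ phi w"
  by (simp add: phi_def)

lemma phi_append [simp]: "phi (v @ w) = phi v @ phi w"
  by (simp add: phi_def)

lemma phi_funpow_append: "(phi ^^ n) (v @ w) = (phi ^^ n) v @ (phi ^^ n) w"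
  by (induction n) auto

text \<open>This turns out to be \<open>psi h (h + n)\<close> without its last letter, the word on
  which \<open>phi_R\<close> acts in the theorem.\<close>

definition stem :: "nat \<Rightarrow> nat \<Rightarrow> nat list" where
  "stem h n = butlast ((phi ^^ n) [h])"

abbreviation Q :: "nat \<Rightarrow> nat list" where
  "Q \<equiv> stem 0"

lemma phi_funpow_letter: "(phi ^^ n) [h] = stem h n @ [h + n]"
proof (induction n)
  case 0
  then show ?case by (simp add: stem_def)
next
  case (Suc n)
  have "last ((phi ^^ Suc n) [h]) = h + Suc n" "(phi ^^ Suc n) [h] \<noteq> []"
    by (simp_all add: Suc phi_Cons phi_letter_eq)
  then show ?case
    unfolding stem_def by (metis append_butlast_last_id)
qed

lemma phi_funpow_00: "(phi ^^ a) [0, 0] = Q a @ a # Q a @ [a]"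
  using phi_funpow_append[of a "[0]" "[0]"] by (simp add: phi_funpow_letter)

lemma phi_letter_Q: "phi_letter a = a # Q a @ a # Q a @ [Suc a]"
  by (simp add: phi_letter_eq phi_funpow_00 right_shift_def butlast_append)

lemma stem_0 [simp]: "stem h 0 = []"
  by (simp add: stem_def)

lemma stem_Suc: "stem h (Suc n) = phi (stem h n) @ (h + n) # Q (h + n) @ (h + n) # Q (h + n)"
proof -
  have "stem h (Suc n) @ [h + Suc n] = phi (stem h n @ [h + n])"
    using phi_funpow_letter[of "Suc n" h] by (simp add: phi_funpow_letter)
  then show ?thesis by (simp add: phi_Cons phi_letter_Q)
qed

lemma set_phi: "set (phi w) \<subseteq> {..<Suc n}" if "set w \<subseteq> {..<n}"
proof -
  have "c \<le> d + 1" if "c \<in> set (phi_letter d)" for c d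
    using phi_letter_aux that by blast
  then show ?thesis
    using that by (fastforce simp: phi_def)
qed

lemma set_Q: "set (Q a) \<subseteq> {..<a}"
proof (induction a)
  case (Suc a)
  then show ?case
    using set_phi[OF Suc] by (auto simp: stem_Suc)
qed simp

lemma set_stem: "set (stem h n) \<subseteq> {..<h + n}"
proof (induction n)
  case (Suc n)
  then show ?case
    using set_phi[OF Suc] set_Q[of "h + n"] by (fastforce simp: stem_Suc)
qed simp

lemma phi_eq_Nil_iff [simp]: "phi w = [] \<longleftrightarrow> w = []"
  by (cases w) (auto simp: phi_Cons phi_letter_Q)

lemma hd_phi: "w \<noteq> [] \<Longrightarrow> hd (phi w) = hd w"
  by (cases w) (auto simp: phi_Cons phi_letter_Q)

lemma last_phi: "w \<noteq> [] \<Longrightarrow> last (phi w) = Suc (last w)"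
  by (cases w rule: rev_cases) (auto simp: phi_Cons phi_letter_Q)

lemma Q_nonempty: "a > 0 \<Longrightarrow> Q a \<noteq> []"
  by (cases a) (auto simp: stem_Suc)

lemma hd_Q: "a > 0 \<Longrightarrow> hd (Q a) = 0"
proof (induction a)
  case (Suc a)
  then show ?case
    by (cases "a = 0") (simp_all add: stem_Suc Q_nonempty hd_phi)
qed simp

lemma last_Q: "a > 0 \<Longrightarrow> last (Q a) = 0"
proof (induction a)
  case (Suc a)
  then show ?case
    by (cases "a = 0") (simp_all add: stem_Suc Q_nonempty)
qed simp


subsection \<open>Decoding\<close>

text \<open>A block \<open>phi_letter a\<close> starts with \<open>a\<close>, so an image can be
  decoded from the left; its last letter \<open>Suc a\<close> allows the same from the right in
  \<open>phi_suffix_decode\<close>.\<close>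

lemma phi_prefix_decode: "phi w = phi y @ t \<Longrightarrow> \<exists>v. w = y @ v \<and> phi v = t"
proof (induction y arbitrary: w)
  case (Cons a y)
  then obtain w' where "w = a # w'"
    by (cases w) (auto simp: phi_Cons phi_letter_Q)
  with Cons show ?case by (auto simp: phi_Cons)
qed simp

lemma phi_suffix_decode: "phi w = t @ phi y \<Longrightarrow> \<exists>v. w = v @ y \<and> phi v = t"
proof (induction y arbitrary: w rule: rev_induct)
  case (snoc a y)
  then have "w \<noteq> []" by auto
  moreover from this have "last w = a"
    using last_phi[of w] last_phi[of "[a]"] snoc.prems by simp
  ultimately
  obtain w' where "w = w' @ [a]"
    by (metis append_butlast_last_id)
  with snoc show ?case by (auto simp: phi_Cons)
qed simp

lemma phi_split_block:
  assumes "phi w = X @ m # Y"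
  obtains w1 a w2 s s' where "w = w1 @ a # w2" "phi_letter a = s @ m # s'"
    "X = phi w1 @ s" "Y = s' @ phi w2"
  using assms
proof (induction w arbitrary: X thesis)
  case (Cons a w)
  from Cons.prems(2) consider
      us where "phi_letter a = X @ us" "us @ phi w = m # Y"
    | us where "X = phi_letter a @ us" "phi w = us @ m # Y"
    by (auto simp: phi_Cons append_eq_append_conv2)
  then show ?case
  proof cases
    case 1
    show ?thesis
    proof (cases us)
      case Nil
      show ?thesis
      proof (rule Cons.IH[of "[]"])
        show "phi w = [] @ m # Y" using 1 Nil by simp
        fix w1 b w2 s s'
        assume "w = w1 @ b # w2" "phi_letter b = s @ m # s'" "[] = phi w1 @ s" "Y = s' @ phi w2"
        then show ?thesis
          using Cons.prems(1)[of "a # w1" b w2 s s'] 1 Nil by (simp add: phi_Cons)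
      qed
    next
      case (Cons _ s')
      then show ?thesis
        using Cons.prems(1)[of "[]" a w X s'] 1 by simp
    qed
  next
    case 2
    show ?thesis
    proof (rule Cons.IH[OF _ 2(2)])
      fix w1 b w2 s s'
      assume "w = w1 @ b # w2" "phi_letter b = s @ m # s'" "us = phi w1 @ s" "Y = s' @ phi w2"
      then show ?thesis
        using Cons.prems(1)[of "a # w1" b w2 s s'] 2 by (simp add: phi_Cons)
    qed
  qed
qed simp


subsection \<open>Overlaps\<close>

lemma overlap_free_iff:
  "overlap_free w \<longleftrightarrow> (\<nexists>p c x s. w = p @ c # x @ c # x @ c # s)"
  by (auto simp: overlap_free_def sublist_def)

lemma overlap_free_sublist: "overlap_free w \<Longrightarrow> sublist v w \<Longrightarrow> overlap_free v"
  unfolding overlap_free_def by (meson sublist_order.order_trans)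

lemma overlap_count:
  assumes "w = p @ c # x @ c # x @ c # s"
  shows "count_list w c \<ge> 3"
  using assms by simp

text \<open>
  If the two marked letters of the square end blocks, then the overlap is the image of an
  overlap: the partial blocks at its two ends are determined by the letter \<open>c\<close> they share.
\<close>

lemma overlap_synchronised:
  assumes "phi w = \<alpha> @ z1 @ m # z2 @ z1 @ m # z2 @ c # \<beta>" and c: "c = hd (z1 @ [m])"
    and w: "w = w1 @ w2 @ w3"
    and w1: "phi w1 = \<alpha> @ z1 @ [m]" and w2: "phi w2 = z2 @ z1 @ [m]"
    and w3: "phi w3 = z2 @ c # \<beta>"
  shows "\<not> overlap_free w"
proof -
  obtain y b w3' t0 t' where d: "w3 = y @ b # w3'" "phi_letter b = t0 @ c # t'"
      "z2 = phi y @ t0" "\<beta> = t' @ phi w3'"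
    using phi_split_block[OF w3] by blast
  define r where "r = tl (z1 @ [m])"
  have r: "z1 @ [m] = c # r"
    using c by (cases z1) (auto simp: r_def)
  have hb: "hd (t0 @ [c]) = b"
    using d(2) by (cases t0) (auto simp: phi_letter_Q)
  \<comment> \<open>The block of \<open>b\<close>, which contains the last \<open>c\<close>, is
    recognised in \<open>w2\<close> by its first letter, found in \<open>t0 @ [c]\<close>, and in
    \<open>w1\<close> by its last letter, found in \<open>c # t'\<close>.\<close>
  obtain v where v: "w2 = y @ v" "phi v = t0 @ c # r"
    using phi_prefix_decode[of w2 y "t0 @ c # r"] w2 d(3) r by auto
  then have "v \<noteq> []" by auto
  then have "hd v = b"
    using hd_phi[of v] v(2) hb by (cases t0) auto
  with \<open>v \<noteq> []\<close> obtain w2' where w2': "v = b # w2'" by (cases v) auto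
  with v(2) d(2) have r': "r = t' @ phi w2'" by (simp add: phi_Cons)
  have "phi w1 = (\<alpha> @ c # t') @ phi w2'"
    using w1 r r' by simp
  then obtain u where u: "w1 = u @ w2'" "phi u = \<alpha> @ c # t'"
    using phi_suffix_decode by blast
  have "u \<noteq> []" using u by auto
  moreover have "last (c # t') = Suc b"
    using arg_cong[OF d(2), of last] by (simp add: phi_letter_Q split: if_splits)
  ultimately have "last u = b"
    using last_phi[of u] u(2) by simp
  with \<open>u \<noteq> []\<close> obtain u' where "u = u' @ [b]"
    by (metis append_butlast_last_id)
  then have "w = u' @ b # (w2' @ y) @ b # (w2' @ y) @ b # w3'"
    using w u v w2' d by simp
  then show ?thesis unfolding overlap_free_iff by blast
qed


text \<open>
  An overlap in the middle part of \<open>phi_letter a\<close> cannot use the leading \<open>a\<close>, which occurs only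
  twice there.
\<close>

lemma overlap_free_phi_letter:
  assumes "overlap_free ((phi ^^ a) [0, 0])"
  shows "overlap_free (phi_letter a)"
proof (rule ccontr)
  assume "\<not> ?thesis"
  then obtain p c x s where eq: "phi_letter a = p @ c # x @ c # x @ c # s"
    unfolding overlap_free_iff by blast
  have "count_list (phi_letter a) c \<ge> 3"
    using overlap_count[OF eq] .
  moreover have "count_list (Q a) a = 0" "count_list (Q a) (Suc a) = 0"
    using set_Q[of a] by (auto simp: count_list_0_iff)
  ultimately have c: "c \<noteq> a" "c \<noteq> Suc a"
    by (auto simp: phi_letter_Q)
  obtain p' where p: "p = a # p'"
    using eq c by (cases p) (auto simp: phi_letter_Q)
  obtain s' where s: "s = s' @ [Suc a]"
    using eq c by (cases s rule: rev_cases) (auto simp: phi_letter_Q)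
  have "Q a @ a # Q a = p' @ c # x @ c # x @ c # s'"
    using eq p s by (simp add: phi_letter_Q)
  then have "\<not> overlap_free (Q a @ a # Q a)"
    unfolding overlap_free_iff by blast
  moreover have "sublist (Q a @ a # Q a) ((phi ^^ a) [0, 0])"
    unfolding phi_funpow_00 sublist_def by (intro exI[of _ "[]"] exI[of _ "[a]"]) simp
  ultimately show False
    using assms overlap_free_sublist by blast
qed

lemma phi_letter_position:
  assumes "phi_letter a = s @ m # s'" "s' \<noteq> []"
  shows "m \<le> a" "last s' = Suc a" "hd (s @ [m]) = a"
proof -
  obtain t where t: "s' = t @ [last s']"
    using assms(2) by (metis append_butlast_last_id)
  have eq: "(a # Q a @ a # Q a) @ [Suc a] = (s @ m # t) @ [last s']"
    using assms(1) t by (simp add: phi_letter_Q)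
  then show "last s' = Suc a" by auto
  have "m \<in> set (a # Q a @ a # Q a)"
    using eq by simp
  then show "m \<le> a" using set_Q[of a] by auto
  show "hd (s @ [m]) = a"
    using assms(1) by (cases s) (auto simp: phi_letter_Q)
qed

text \<open>Meant for the rest \<open>z @ [c]\<close> of an overlap after a marked letter inside a
  block: the block's end \<open>Suc a\<close> exceeds all these letters, so the block outlasts the
  overlap.\<close>

lemma prefix_of_long_block:
  assumes "s' @ u = z @ c # v" "last s' = Suc a" "s' \<noteq> []" "\<forall>b\<in>set (z @ [c]). b \<le> a"
  obtains t where "s' = z @ c # t"
proof -
  from assms(1) have "s' @ u = (z @ [c]) @ v" by simp
  then consider t where "s' = (z @ [c]) @ t" | t where "z @ [c] = s' @ t"
    unfolding append_eq_append_conv2 by metis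
  then show ?thesis
  proof cases
    case 2
    then have "Suc a \<in> set (z @ [c])"
      using assms(2,3) last_in_set[of s'] by auto
    then show ?thesis using assms(4) by auto
  qed (use that in auto)
qed

lemma middle_letter_unique:
  assumes "Q m @ m # Q m @ [Suc m] = x @ m # y"
  shows "x = Q m" "y = Q m @ [Suc m]"
proof -
  have "m \<notin> set (Q m)" "m \<notin> set (Q m @ [Suc m])"
    using set_Q[of m] by auto
  then show "x = Q m" "y = Q m @ [Suc m]"
    using assms append_Cons_eq_iff[of m "Q m" "Q m @ [Suc m]" x y] by auto
qed

lemma overlap_free_phi:
  assumes w: "overlap_free w" and letters: "\<And>a. a \<in> set w \<Longrightarrow> overlap_free (phi_letter a)"
  shows "overlap_free (phi w)"
proof (rule ccontr)
  assume "\<not> ?thesis"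
  then obtain \<alpha> c x \<beta> where eq0: "phi w = \<alpha> @ (c # x) @ (c # x) @ c # \<beta>"
    unfolding overlap_free_iff by auto
  define m where "m = Max (set (c # x))"
  have "m \<in> set (c # x)" unfolding m_def by (intro Max_in) auto
  then obtain z1 z2 where z: "c # x = z1 @ m # z2" "m \<notin> set z1"
    by (meson split_list_first)
  have "\<forall>b\<in>set (c # x). b \<le> m" unfolding m_def by auto
  then have max: "\<forall>b\<in>set (z1 @ m # z2). b \<le> m" by (simp only: z)
  have c: "c = hd (z1 @ [m])"
    using z(1) by (cases z1) auto
  then have cm: "c \<le> m"
    using max by (cases z1) auto
  have eq: "phi w = \<alpha> @ z1 @ m # z2 @ z1 @ m # z2 @ c # \<beta>"
    using eq0 by (simp only: z append.assoc append_Cons)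

  obtain w1 a w2 s s' where 1: "w = w1 @ a # w2" "phi_letter a = s @ m # s'"
      "\<alpha> @ z1 = phi w1 @ s" "z2 @ z1 @ m # z2 @ c # \<beta> = s' @ phi w2"
    using phi_split_block[OF eq[folded append.assoc[of \<alpha>]]] by blast
  have "s' = []"
  proof (rule ccontr)
    assume s': "s' \<noteq> []"
    note pos = phi_letter_position[OF 1(2) s']
    have "\<forall>b\<in>set ((z2 @ z1 @ m # z2) @ [c]). b \<le> a"
      using pos(1) max cm by (auto intro: order_trans)
    then obtain us where us: "s' = (z2 @ z1 @ m # z2) @ c # us"
      using prefix_of_long_block[OF _ pos(2) s', of "phi w2" "z2 @ z1 @ m # z2" c \<beta>] 1(4)
      by auto
    from 1(3) consider r where "s = r @ z1" | r where "z1 = r @ s" "phi w1 = \<alpha> @ r" "r \<noteq> []"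
      unfolding append_eq_append_conv2 by (metis append_Nil)
    then show False
    proof cases
      \<comment> \<open>Here the whole overlap lies in a single block.\<close>
      case 1
      have "phi_letter a = r @ (z1 @ m # z2) @ (z1 @ m # z2) @ c # us"
        using \<open>phi_letter a = s @ m # s'\<close> us 1 by simp
      then have "phi_letter a = r @ c # x @ c # x @ c # us"
        by (simp add: z(1)[symmetric])
      then have "\<not> overlap_free (phi_letter a)"
        unfolding overlap_free_iff by blast
      with letters \<open>w = w1 @ a # w2\<close> show False by auto
    next
      \<comment> \<open>The block must be \<open>phi_letter m\<close>, starting at the first marked
        letter, and the second marked letter is its middle \<open>m\<close>. So \<open>r\<close>
        ends like \<open>Q m\<close>, with \<open>0\<close>, although \<open>r\<close> ends where a
        block ends.\<close>
      case 2
      have "a \<le> m" using pos(3) max 2(1) by (cases s) auto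
      with pos have [simp]: "a = m" by simp
      have [simp]: "s = []"
        using pos(3) z(2) 2(1) by (cases s) auto
      have "Q m @ m # Q m @ [Suc m] = (z2 @ r) @ m # z2 @ c # us"
        using 1(2) us 2(1) by (simp add: phi_letter_Q)
      from middle_letter_unique(1)[OF this] have "last (Q m) = last r" "Q m \<noteq> []"
        using 2(3) by (metis last_appendR, metis append_is_Nil_conv)
      moreover have "last r = last (phi w1)" "w1 \<noteq> []"
        using 2 by auto
      ultimately show False
        using last_phi[of w1] last_Q[of m] by (cases "m = 0") auto
    qed
  qed
  then have m: "m = Suc a" and s: "s = a # Q a @ a # Q a"
    using 1(2) by (auto simp: phi_letter_Q)
  have v1: "phi (w1 @ [a]) = \<alpha> @ z1 @ [m]"
    using 1(2,3) \<open>s' = []\<close> by (simp add: phi_Cons)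
  have v2: "phi w2 = z2 @ z1 @ m # z2 @ c # \<beta>"
    using 1(4) \<open>s' = []\<close> by simp
  \<comment> \<open>Hence \<open>z1\<close>, if nonempty, cannot end where a block ends. For
    \<open>a = 0\<close> the word \<open>Q a\<close> is empty and the \<open>0\<close> is
    \<open>a\<close> itself.\<close>
  have last_z1: "last z1 = 0" if "z1 \<noteq> []"
  proof -
    have "last z1 = last s"
      using arg_cong[OF 1(3), of last] that s by simp
    then show ?thesis
      using last_Q[of a] s by (cases "a = 0") (auto simp: Q_nonempty)
  qed

  obtain w3 b w4 s2 s2' where 2: "w2 = w3 @ b # w4" "phi_letter b = s2 @ m # s2'"
      "z2 @ z1 = phi w3 @ s2" "z2 @ c # \<beta> = s2' @ phi w4"
    using phi_split_block[OF v2[folded append.assoc]] by blast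
  have "s2' = []"
  proof (rule ccontr)
    assume s2': "s2' \<noteq> []"
    note pos = phi_letter_position[OF 2(2) s2']
    have "\<forall>e\<in>set (z2 @ [c]). e \<le> b"
      using pos(1) max cm by (auto intro: order_trans)
    then obtain us where us: "s2' = z2 @ c # us"
      using prefix_of_long_block[OF 2(4)[symmetric] pos(2) s2'] by blast
    have "set s2 \<subseteq> set (z2 @ z1)" using 2(3) by simp
    then have "b \<le> m" using pos(3) max by (cases s2) auto
    with pos have [simp]: "b = m" by simp
    show False
    proof (cases s2)
      \<comment> \<open>The block starts at the second marked letter, so \<open>z2 @ z1\<close> ends
        where a block ends. This forces \<open>z1 = []\<close> and \<open>c = m\<close>; then
        \<open>z2 = Q m\<close> ends with \<open>0\<close>, again impossible at the end of a
        block.\<close>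
      case Nil
      have "z1 = []"
      proof (rule ccontr)
        assume "z1 \<noteq> []"
        then have "last (phi w3) = 0" "w3 \<noteq> []"
          using last_z1 2(3) Nil by (metis append_Nil2 last_appendR, auto)
        then show False using last_phi[of w3] by simp
      qed
      with c 2(2,3) us Nil have "Q m @ m # Q m @ [Suc m] = z2 @ m # us" and z2: "z2 = phi w3"
        by (auto simp: phi_letter_Q)
      from middle_letter_unique(1)[OF this(1)] have "Q m = phi w3" by (simp add: z2)
      moreover have "Q m \<noteq> []" "last (Q m) = 0"
        using Q_nonempty[of m] last_Q[of m] m by auto
      ultimately have "w3 \<noteq> []" "last (phi w3) = 0"
        by auto
      then show False
        using last_phi[of w3] by simp
    next
      \<comment> \<open>The second marked letter is the middle \<open>m\<close> of the block. The
        leading \<open>m\<close> of the block lies in \<open>z2 @ z1\<close>, where no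
        \<open>m\<close> is left.\<close>
      case (Cons d s3)
      then have "d = m" using pos(3) by simp
      with 2(2) us Cons have "Q m @ m # Q m @ [Suc m] = s3 @ m # z2 @ c # us"
        by (simp add: phi_letter_Q)
      from middle_letter_unique(2)[OF this] have "z2 @ c # us = Q m @ [Suc m]" .
      then have "set z2 \<subseteq> set (Q m @ [Suc m])"
        by (metis set_append sup_ge1)
      then have "m \<notin> set z2"
        using set_Q[of m] by auto
      moreover have "m \<in> set (z2 @ z1)"
        using 2(3) Cons \<open>d = m\<close> by simp
      ultimately show False using z(2) by simp
    qed
  qed
  have "\<not> overlap_free w"
  proof (rule overlap_synchronised[OF eq c, of "w1 @ [a]" "w3 @ [b]" w4])
    show "w = (w1 @ [a]) @ (w3 @ [b]) @ w4" using 1(1) 2(1) by simp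
    show "phi (w1 @ [a]) = \<alpha> @ z1 @ [m]" by (fact v1)
    show "phi (w3 @ [b]) = z2 @ z1 @ [m]" using 2 \<open>s2' = []\<close> by (simp add: phi_Cons)
    show "phi w4 = z2 @ c # \<beta>" using 2 \<open>s2' = []\<close> by simp
  qed
  with w show False by contradiction
qed

text \<open>The letters of \<open>(phi ^^ b) [0, 0]\<close> are at most \<open>b\<close>, so the
  induction hypothesis also makes their blocks overlap-free.\<close>

lemma overlap_free_phi_funpow_00: "overlap_free ((phi ^^ a) [0, 0])"
proof (induction a rule: less_induct)
  case (less a)
  show ?case
  proof (cases a)
    case 0
    then show ?thesis by (auto simp: overlap_free_iff Cons_eq_append_conv append_eq_Cons_conv)
  next
    case (Suc b)
    have "overlap_free (phi_letter c)" if "c \<in> set ((phi ^^ b) [0, 0])" for c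
      using that less.IH[of c] set_Q[of b] Suc
      by (intro overlap_free_phi_letter) (auto simp: phi_funpow_00)
    then show ?thesis
      using overlap_free_phi[OF less.IH[of b]] Suc by simp
  qed
qed

lemma overlap_free_phi_funpow: "overlap_free w \<Longrightarrow> overlap_free ((phi ^^ n) w)"
  by (induction n)
    (simp_all add: overlap_free_phi overlap_free_phi_letter overlap_free_phi_funpow_00)


subsection \<open>Greediness\<close>

definition greedy :: "nat list \<Rightarrow> bool" where
  "greedy w \<longleftrightarrow> (\<forall>p c s d. w = p @ c # s \<and> p \<noteq> [] \<and> d < c \<longrightarrow> \<not> overlap_free (p @ [d]))"

lemma greedyD: "greedy w \<Longrightarrow> w = p @ c # s \<Longrightarrow> p \<noteq> [] \<Longrightarrow> d < c \<Longrightarrow> \<not> overlap_free (p @ [d])"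
  unfolding greedy_def by blast

text \<open>The word starts with \<open>0\<close>, which cannot be lowered, so exempting the first
  letter costs nothing here.\<close>

lemma greedy_Q_decrease:
  assumes "greedy (Q a @ [a])" "Q a @ [a] = r @ c # t" "d < c"
  shows "\<not> overlap_free (r @ [d])"
proof -
  have "r \<noteq> []"
  proof
    assume "r = []"
    then have "c = 0"
      using assms(2) hd_Q[of a] Q_nonempty[of a] by (cases "Q a"; cases "a = 0") auto
    with assms(3) show False by simp
  qed
  with assms greedyD show ?thesis by blast
qed

lemma not_overlap_free_append: "\<not> overlap_free v \<Longrightarrow> \<not> overlap_free (u @ v)"
  using overlap_free_sublist by (metis sublist_append_leftI)

text \<open>After its leading \<open>a\<close> the block reads \<open>Q a @ [a]\<close> and then
  \<open>Q a @ [Suc a]\<close>. Greediness of \<open>Q a @ [a]\<close> covers every lowering except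
  that of \<open>Suc a\<close> to \<open>a\<close>, which completes the overlap
  \<open>a # Q a @ a # Q a @ [a]\<close>.\<close>

lemma greedy_phi_letter_decrease:
  assumes Q: "greedy (Q a @ [a])" and eq: "phi_letter a = s @ c # s'" "s \<noteq> []" and d: "d < c"
  shows "\<not> overlap_free (s @ [d])"
proof -
  from eq obtain r where s: "s = a # r" and r: "(Q a @ [a]) @ Q a @ [Suc a] = r @ c # s'"
    by (cases s) (auto simp: phi_letter_Q)
  have "\<exists>u v. s = u @ v \<and> \<not> overlap_free (v @ [d])"
  proof -
    from r consider t where "Q a @ [a] = r @ c # t"
      | t where "r = Q a @ a # t" "Q a @ [Suc a] = t @ c # s'"
      by (fastforce simp: append_eq_append_conv2 Cons_eq_append_conv append_eq_Cons_conv)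
    then show ?thesis
    proof cases
      case 1
      then show ?thesis
        using greedy_Q_decrease[OF Q 1 d] s by (intro exI[of _ "[a]"] exI[of _ r]) simp
    next
      case 2
      show ?thesis
      proof (cases s' rule: rev_cases)
        case Nil
        with 2 have t: "t = Q a" "c = Suc a" by auto
        show ?thesis
        proof (cases "d = a")
          case True
          have "\<not> overlap_free (s @ [d])"
            unfolding overlap_free_iff using s t 2 True by force
          then show ?thesis by (intro exI[of _ "[]"] exI[of _ s]) simp
        next
          case False
          then have "\<not> overlap_free (Q a @ [d])"
            using greedy_Q_decrease[OF Q, of "Q a" a "[]" d] d t by simp
          then show ?thesis
            using s t 2 by (intro exI[of _ "a # Q a @ [a]"] exI[of _ "Q a"]) simp
        qed
      next
        case (snoc s'' e)
        with 2 have "Q a @ [a] = t @ c # s'' @ [a]" by simp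
        from greedy_Q_decrease[OF Q this d] show ?thesis
          using s 2 by (intro exI[of _ "a # Q a @ [a]"] exI[of _ t]) simp
      qed
    qed
  qed
  then obtain u v where "s = u @ v" "\<not> overlap_free (v @ [d])" by blast
  then show ?thesis using not_overlap_free_append[of "v @ [d]" u] by simp
qed

lemma greedy_phi:
  assumes w: "overlap_free w" "greedy w" and letters: "\<And>a. a \<in> set w \<Longrightarrow> greedy (Q a @ [a])"
  shows "greedy (phi w)"
  unfolding greedy_def
proof (intro allI impI, elim conjE)
  fix X c Y d assume eq: "phi w = X @ c # Y" and X: "X \<noteq> []" and d: "(d::nat) < c"
  obtain w1 a w2 s s' where 1: "w = w1 @ a # w2" "phi_letter a = s @ c # s'"
      "X = phi w1 @ s" "Y = s' @ phi w2"
    by (rule phi_split_block[OF eq])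
  show "\<not> overlap_free (X @ [d])"
  proof (cases s)
    case Nil
    with 1 X have "c = a" "w1 \<noteq> []" by (auto simp: phi_letter_Q)
    then have "\<not> overlap_free (w1 @ [d])"
      using greedyD[OF w(2) 1(1), of d] d by simp
    then obtain \<alpha> e x \<beta> where o: "w1 @ [d] = \<alpha> @ e # x @ e # x @ e # \<beta>"
      unfolding overlap_free_iff by blast
    \<comment> \<open>An overlap ending before \<open>d\<close> would already lie in
      \<open>w\<close>.\<close>
    have "\<beta> = []"
    proof (rule ccontr)
      assume "\<beta> \<noteq> []"
      then have "w1 = \<alpha> @ e # x @ e # x @ e # butlast \<beta>"
        using arg_cong[OF o, of butlast] by (simp add: butlast_append)
      then have "w = \<alpha> @ e # x @ e # x @ e # butlast \<beta> @ a # w2"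
        using 1(1) by simp
      then have "\<not> overlap_free w" unfolding overlap_free_iff by blast
      with w show False by simp
    qed
    then have "w1 = \<alpha> @ d # x @ d # x"
      using arg_cong[OF o, of butlast] arg_cong[OF o, of last] by (simp add: butlast_append)
    \<comment> \<open>Of the image of the third \<open>d\<close> only the first letter is present,
      but that letter is \<open>d\<close>, so the overlap survives with \<open>y @ phi x\<close> in
      place of \<open>x\<close>.\<close>
    moreover obtain y where "phi_letter d = d # y" by (simp add: phi_letter_Q)
    ultimately have "X @ [d] = phi \<alpha> @ d # (y @ phi x) @ d # (y @ phi x) @ d # []"
      using 1 Nil by (simp add: phi_Cons)
    then show ?thesis unfolding overlap_free_iff by blast
  next
    case Cons
    then have "\<not> overlap_free (s @ [d])"
      using greedy_phi_letter_decrease[OF letters 1(2) _ d] 1(1) by simp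
    then show ?thesis
      using not_overlap_free_append[of "s @ [d]" "phi w1"] 1(3) by simp
  qed
qed

lemma overlap_free_singleton: "overlap_free [a]"
  by (auto simp: overlap_free_iff Cons_eq_append_conv)

lemma greedy_singleton: "greedy [a]"
  by (auto simp: greedy_def Cons_eq_append_conv)

lemma greedy_Q: "greedy (Q a @ [a])"
proof (induction a rule: less_induct)
  case (less a)
  show ?case
  proof (cases a)
    case 0
    then show ?thesis by (simp add: greedy_singleton)
  next
    case (Suc b)
    have "greedy (phi (Q b @ [b]))"
    proof (rule greedy_phi)
      show "overlap_free (Q b @ [b])"
        using overlap_free_phi_funpow[OF overlap_free_singleton, of b 0]
        by (simp add: phi_funpow_letter)
      show "greedy (Q b @ [b])" using less Suc by simp
      show "greedy (Q c @ [c])" if "c \<in> set (Q b @ [b])" for c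
        using that set_Q[of b] less Suc by auto
    qed
    then show ?thesis
      using phi_funpow_letter[of b 0] phi_funpow_letter[of a 0] Suc by simp
  qed
qed

lemma greedy_phi_funpow: "overlap_free w \<Longrightarrow> greedy w \<Longrightarrow> greedy ((phi ^^ n) w)"
  by (induction n) (simp_all add: greedy_phi greedy_Q overlap_free_phi_funpow)

text \<open>A smaller \<open>v\<close> either is a proper prefix of \<open>w\<close>, so that its
  last letter \<open>k\<close> occurs in \<open>w\<close> too early, or first differs from
  \<open>w\<close> in a lowered letter, which completes an overlap.\<close>

lemma greedy_least:
  assumes w: "greedy w" "overlap_free_from_to h k w" and k: "k \<notin> set (butlast w)"
    and v: "overlap_free_from_to h k v"
  shows "w \<le> v"
proof (rule ccontr)
  assume "\<not> w \<le> v"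
  then have "v \<le> w" "v \<noteq> w" by auto
  from this(1) consider "prefix v w"
    | p c d v' w' where "v = p @ c # v'" "w = p @ d # w'" "c < d"
    unfolding word_le_iff by blast
  then show False
  proof cases
    case 1
    with \<open>v \<noteq> w\<close> obtain a u where "w = v @ a # u"
      by (metis append_Nil2 neq_Nil_conv prefix_def)
    then have "set v \<subseteq> set (butlast w)" by (auto simp: butlast_append)
    moreover have "k \<in> set v" using v by (auto simp: overlap_free_from_to_def)
    ultimately show False using k by blast
  next
    case 2
    then have "p \<noteq> []"
      using v w by (auto simp: overlap_free_from_to_def)
    with greedyD[OF w(1) 2(2)] 2(3) have "\<not> overlap_free (p @ [c])" by blast
    moreover have "sublist (p @ [c]) v"
      unfolding sublist_def by (intro exI[of _ "[]"] exI[of _ v']) (simp add: 2)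
    ultimately show False
      using v overlap_free_sublist by (auto simp: overlap_free_from_to_def)
  qed
qed

lemma hd_phi_funpow: "w \<noteq> [] \<Longrightarrow> (phi ^^ n) w \<noteq> [] \<and> hd ((phi ^^ n) w) = hd w"
  by (induction n) (auto simp: hd_phi)

lemma phi_funpow_least:
  shows "overlap_free_from_to h (h + n) ((phi ^^ n) [h])"
    and "overlap_free_from_to h (h + n) v \<Longrightarrow> (phi ^^ n) [h] \<le> v"
proof -
  show *: "overlap_free_from_to h (h + n) ((phi ^^ n) [h])"
    using hd_phi_funpow[of "[h]" n] overlap_free_phi_funpow[OF overlap_free_singleton, of n h]
    by (simp add: overlap_free_from_to_def phi_funpow_letter)
  show "(phi ^^ n) [h] \<le> v" if "overlap_free_from_to h (h + n) v"
  proof (rule greedy_least[OF _ * _ that])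
    show "greedy ((phi ^^ n) [h])"
      by (simp add: greedy_phi_funpow overlap_free_singleton greedy_singleton)
    show "h + n \<notin> set (butlast ((phi ^^ n) [h]))"
      using set_stem[of h n] by (auto simp: stem_def)
  qed
qed

lemma psi_eq: "psi h (h + n) = (phi ^^ n) [h]"
  unfolding psi_def by (intro Least_equality phi_funpow_least)


subsection \<open>Reversal\<close>

lemma phi_R_append [simp]: "phi_R (v @ w) = phi_R v @ phi_R w"
  by (simp add: phi_R_def)

lemma phi_R_Nil [simp]: "phi_R [] = []"
  by (simp add: phi_R_def)

lemma phi_R_Cons: "phi_R (a # w) = rev (phi_letter a) @ phi_R w"
  using phi_R_append[of "[a]" w] by (simp add: phi_R_letter)

text \<open>For a palindrome \<open>Q a\<close> the reversed argument is
  \<open>(phi ^^ a) [0, 0]\<close>, which \<open>phi\<close> maps to the next iterate.\<close>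

lemma phi_R_block:
  assumes "rev (Q a) = Q a" "rev (Q (Suc a)) = Q (Suc a)"
  shows "phi_R (a # Q a @ a # Q a) = Suc a # Q (Suc a) @ Suc a # Q (Suc a)"
proof -
  have "rev (a # Q a @ a # Q a) = (phi ^^ a) [0, 0]"
    using assms by (simp add: phi_funpow_00)
  then have "phi_R (a # Q a @ a # Q a) = rev ((phi ^^ Suc a) [0, 0])"
    by (simp only: phi_R_def comp_apply funpow.simps)
  then show ?thesis
    using assms by (simp only: phi_funpow_00) simp
qed

text \<open>This is commutation on one letter. The right side is \<open>phi_letter (Suc a)\<close>
  followed by \<open>(phi ^^ Suc a) [0, 0]\<close>; moving the last letter of the former to the
  latter gives the left side.\<close>

lemma phi_R_phi_letter:
  assumes "rev (Q a) = Q a" "rev (Q (Suc a)) = Q (Suc a)"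
  shows "phi_R (phi_letter a) = phi (rev (phi_letter a))"
proof -
  have "phi (rev (phi_letter a)) = phi_letter (Suc a) @ phi ((phi ^^ a) [0, 0])"
    using assms by (simp add: phi_letter_Q[of a] phi_funpow_00 phi_Cons)
  also have "phi ((phi ^^ a) [0, 0]) = (phi ^^ Suc a) [0, 0]" by simp
  also have "phi_letter (Suc a) @ \<dots> =
      (Suc a # Q (Suc a) @ Suc a # Q (Suc a)) @ rev (phi_letter (Suc a))"
    using assms by (simp only: phi_funpow_00) (simp add: phi_letter_Q)
  also have "\<dots> = phi_R (a # Q a @ a # Q a) @ phi_R [Suc a]"
    using assms by (simp only: phi_R_block phi_R_letter)
  also have "\<dots> = phi_R (phi_letter a)"
    unfolding phi_R_append[symmetric] by (simp add: phi_letter_Q)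
  finally show ?thesis ..
qed

lemma phi_R_phi_commute:
  "(\<And>a. a \<in> set w \<Longrightarrow> rev (Q a) = Q a \<and> rev (Q (Suc a)) = Q (Suc a)) \<Longrightarrow>
    phi_R (phi w) = phi (phi_R w)"
  by (induction w) (simp_all add: phi_Cons phi_R_Cons phi_R_phi_letter)

text \<open>The palindrome hypothesis stops at \<open>h + n\<close>, so that the case
  \<open>h = 0\<close> can serve inside the induction for \<open>rev_Q\<close>.\<close>

lemma phi_R_stem_aux:
  "(\<And>a. a \<le> h + n \<Longrightarrow> rev (Q a) = Q a) \<Longrightarrow> phi_R (stem h n) = stem (Suc h) n"
proof (induction n)
  case (Suc n)
  have "phi_R (phi (stem h n)) = phi (phi_R (stem h n))"
    using set_stem[of h n] Suc.prems by (intro phi_R_phi_commute) (auto simp: subset_iff)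
  moreover have "phi_R (stem h n) = stem (Suc h) n"
    using Suc by simp
  moreover have "rev (Q (h + n)) = Q (h + n)" "rev (Q (Suc (h + n))) = Q (Suc (h + n))"
    using Suc.prems by simp_all
  ultimately show ?case
    by (simp only: stem_Suc[of h] stem_Suc[of "Suc h"] phi_R_append phi_R_block add_Suc)
qed simp

text \<open>Expanding \<open>(phi ^^ Suc b) [0]\<close> at the innermost \<open>phi\<close> gives
  \<open>(phi ^^ b) [0, 0] @ stem 1 b\<close> for \<open>Q (Suc b)\<close>, and at the outermost
  gives \<open>stem_Suc\<close>. With \<open>stem 1 b = rev (phi (Q b))\<close> these two
  expressions are reverses of each other.\<close>

lemma rev_Q: "rev (Q a) = Q a"
proof (induction a rule: less_induct)
  case (less a)
  show ?case
  proof (cases a)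
    case (Suc b)
    have pal: "rev (Q b) = Q b" using less Suc by simp
    have "(phi ^^ Suc b) [0] = (phi ^^ b) [0, 0] @ (phi ^^ b) [1]"
      unfolding phi_funpow_append[symmetric]
      by (simp only: funpow_Suc_right comp_apply) (simp add: phi_Cons phi_letter_0)
    then have "Q a = (phi ^^ b) [0, 0] @ stem 1 b"
      using Suc by (simp only: phi_funpow_letter) simp
    also have "stem 1 b = rev (phi (Q b))"
      using phi_R_stem_aux[of 0 b] less Suc pal by (simp add: phi_R_def)
    also have "(phi ^^ b) [0, 0] @ \<dots> = rev (Q a)"
      using Suc pal by (simp add: stem_Suc phi_funpow_00)
    finally show ?thesis ..
  qed simp
qed

lemma phi_R_stem: "phi_R (stem h n) = stem (Suc h) n"
  by (simp add: phi_R_stem_aux rev_Q)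

lemma phi_R_funpow_stem: "(phi_R ^^ i) (stem h n) = stem (h + i) n"
  by (induction i) (simp_all add: phi_R_stem)

theorem theorem17:
  fixes h k i :: nat
  assumes "h \<le> k"
  shows "(\<exists>m. overlap_free_from_to h k m \<and> (\<forall>w. overlap_free_from_to h k w \<longrightarrow> m \<le> w)) \<and>
         psi h (k + i) = (phi ^^ i) (psi h k) \<and>
         psi (h + i) (k + i) = (phi_R ^^ i) (butlast (psi h k)) @ [k + i]"
proof (intro conjI)
  from assms obtain n where k: "k = h + n" by (metis le_add_diff_inverse)
  \<comment> \<open>The lexicographic order on words is not well-founded, so that the
    \<open>LEAST\<close> in \<open>psi\<close> is attained needs proof.\<close>
  show "\<exists>m. overlap_free_from_to h k m \<and> (\<forall>w. overlap_free_from_to h k w \<longrightarrow> m \<le> w)"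
    using phi_funpow_least k by blast
  show "psi h (k + i) = (phi ^^ i) (psi h k)"
    using psi_eq[of h "i + n"] by (simp add: k psi_eq funpow_add ac_simps)
  have "psi (h + i) (k + i) = stem (h + i) n @ [k + i]"
    using psi_eq[of "h + i" n] by (simp add: k phi_funpow_letter ac_simps)
  then show "psi (h + i) (k + i) = (phi_R ^^ i) (butlast (psi h k)) @ [k + i]"
    by (simp add: k psi_eq stem_def[symmetric] phi_R_funpow_stem)
qed

end
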